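(* Let $b\in\mathbb R^n$, let $S(b)=\{z\in\mathbb R^n: z\ge b\}$, and let $F:S(b)\to S(b)$ be isotonic. Assume in addition that $F$ is concave and $F(b)>b$. If $F$ has a fixpoint $z^*$, then: 1. the set $\mathrm{Low}(F)=\{z\in S(b): z\le F(z)\}$ is bounded; 2. the largest element of $\mathrm{Low}(F)$ is $z^*$.
   Context: Comparison of vectors in $\mathbb R^n$ is coordinatewise; $F(b)>b$ means $F_j(b)>b_j$ for every coordinate $j$. $F$ is isotonic if $z\le z'$ implies $F(z)\le F(z')$ for all $z,z'\in S(b)$. $F$ is concave if each of its coordinates $F_j$ is a concave function on $S(b)$. A fixpoint of $F$ is a (finite) $z\in S(b)$ with $F(z)=z$. *)

theory Defs
  imports "HOL-Analysis.Analysis"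
begin

(* The order on real ^ 'n is coordinatewise (less_eq_vec_def), so {b..} is the upper orthant
   S(b) = {z. z >= b}.  A map on S(b) is a total function of which only the values on {b..}
   matter; hence b is a parameter of Low. *)

definition Low :: "real ^ 'n \<Rightarrow> (real ^ 'n \<Rightarrow> real ^ 'n) \<Rightarrow> (real ^ 'n) set"
  where "Low b F = {z \<in> {b..}. z \<le> F z}"

end

theory Submission
  imports Defs
begin

text \<open>If some z in Low is not below z*, walk from b towards z until the first point w at which a
coordinate j reaches z*. Such a point exists strictly between b and z, since z* > b. Concavity along
the segment and F(b) > b give F_j(w) > w_j, while isotonicity gives F_j(w) \<le> z*_j = w_j.\<close>

text \<open>Each coordinate \<open>i\<close> with \<open>u $ i < z $ i\<close> crosses the level
  \<open>u $ i\<close> at a parameter in (0,1), as \<open>b $ i < u $ i\<close>. The least of these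
  finitely many parameters is the first contact.\<close>

lemma exists_contact_point:
  fixes b u z :: "real ^ 'n"
  assumes "\<And>j. b $ j < u $ j" "b \<le> z" "\<not> z \<le> u"
  obtains t j where "0 < t" "t < 1" "(1 - t) *\<^sub>R b + t *\<^sub>R z \<le> u"
    "((1 - t) *\<^sub>R b + t *\<^sub>R z) $ j = u $ j"
proof -
  define J where "J = {i. u $ i < z $ i}"
  \<comment> \<open>The solution \<open>t\<close> of
    \<open>(1 - t) * b $ i + t * z $ i = u $ i\<close>; it is used only on \<open>J\<close>, where
    the denominator is positive.\<close>
  define r where "r i = (u $ i - b $ i) / (z $ i - b $ i)" for i
  have "J \<noteq> {}"
    using assms(3) by (auto simp: J_def less_eq_vec_def not_le)
  then obtain j where j: "j \<in> J" "\<And>i. i \<in> J \<Longrightarrow> r j \<le> r i"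
    using ex_is_arg_min_if_finite[of J r] by (auto simp: is_arg_min_linorder)
  have den: "0 < z $ i - b $ i" if "i \<in> J" for i
    using that assms(1)[of i] by (simp add: J_def)
  have r: "0 < r j" "r j < 1"
    using den[OF j(1)] assms(1)[of j] j(1) by (simp_all add: r_def J_def)
  show ?thesis
  proof (rule that[of "r j" j])
    have "r j * (z $ i - b $ i) \<le> u $ i - b $ i" for i
    proof (cases "i \<in> J")
      case True
      then show ?thesis
        using j(2)[of i] den[of i] by (simp add: r_def[of i] pos_le_divide_eq)
    next
      case False
      \<comment> \<open>Here \<open>z $ i \<le> u $ i\<close>, and the segment rises only as far as
        \<open>z $ i\<close>.\<close>
      have "r j * (z $ i - b $ i) \<le> z $ i - b $ i"
        using assms(2) r by (intro mult_left_le_one_le) (auto simp: less_eq_vec_def)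
      with False show ?thesis by (simp add: J_def)
    qed
    then show "(1 - r j) *\<^sub>R b + r j *\<^sub>R z \<le> u"
      by (simp add: less_eq_vec_def algebra_simps)
    have "r j * (z $ j - b $ j) = u $ j - b $ j"
      using den[OF j(1)] by (simp add: r_def)
    then show "((1 - r j) *\<^sub>R b + r j *\<^sub>R z) $ j = u $ j"
      by (simp add: algebra_simps)
  qed (use r in auto)
qed


theorem theorem7:
  fixes b zstar :: "real ^ 'n"
    and F :: "real ^ 'n \<Rightarrow> real ^ 'n"
  assumes self_map: "F \<in> {b..} \<rightarrow> {b..}"
    and isotonic: "mono_on {b..} F"
    and concave: "\<And>j. concave_on {b..} (\<lambda>z. F z $ j)"
    and above: "\<And>j. b $ j < F b $ j"
    and fixpoint: "zstar \<in> {b..}" "F zstar = zstar"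
  shows "bounded (Low b F)
    \<and> zstar \<in> Low b F \<and> (\<forall>z\<in>Low b F. z \<le> zstar)"
proof -
  have above_b: "b $ j < zstar $ j" for j
  proof -
    \<comment> \<open>The strict gap at \<open>b\<close> passes to the fixpoint:
      \<open>b < F b \<le> F zstar = zstar\<close> in each coordinate.\<close>
    have "F b \<le> F zstar"
      using mono_onD[OF isotonic, of b zstar] fixpoint(1) by simp
    then show ?thesis
      using above[of j] fixpoint(2) by (auto simp: less_eq_vec_def intro: less_le_trans)
  qed
  have below: "z \<le> zstar" if "z \<in> Low b F" for z
  proof (rule ccontr)
    assume "\<not> z \<le> zstar"
    have z: "b \<le> z" "z \<le> F z"
      using that by (auto simp: Low_def)
    obtain t j where t: "0 < t" "t < 1"
      and w: "(1 - t) *\<^sub>R b + t *\<^sub>R z \<le> zstar"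
      and j: "((1 - t) *\<^sub>R b + t *\<^sub>R z) $ j = zstar $ j"
      using exists_contact_point[OF above_b z(1) \<open>\<not> z \<le> zstar\<close>] by blast
    let ?w = "(1 - t) *\<^sub>R b + t *\<^sub>R z"
    have "b \<le> ?w"
    proof -
      have "0 \<le> t * (z $ i - b $ i)" for i
        using z(1) t by (auto simp: less_eq_vec_def)
      then show ?thesis
        by (simp add: less_eq_vec_def algebra_simps)
    qed
    then have "F ?w \<le> F zstar"
      using mono_onD[OF isotonic _ fixpoint(1) w] by simp
    moreover have "?w $ j < F ?w $ j"
    proof -
      have "?w $ j = (1 - t) * b $ j + t * z $ j"
        by simp
      \<comment> \<open>Strictness comes from the endpoint \<open>b\<close>, whose weight
        \<open>1 - t\<close> is positive; the endpoint \<open>z\<close> contributes only a weak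
        inequality.\<close>
      also have "\<dots> < (1 - t) * F b $ j + t * F z $ j"
        using t above[of j] z(2)
        by (intro add_less_le_mono mult_strict_left_mono mult_left_mono)
          (auto simp: less_eq_vec_def)
      also have "\<dots> \<le> F ?w $ j"
        using concave_onD[OF concave[of j], of t b z] t z(1) by simp
      finally show ?thesis .
    qed
    ultimately show False
      using fixpoint(2) j by (metis less_eq_vec_def not_le)
  qed
  \<comment> \<open>The upper bound also settles boundedness: a coordinatewise order interval is a
    closed box.\<close>
  then have "Low b F \<subseteq> {b..zstar}"
    by (auto simp: Low_def)
  then have "bounded (Low b F)"
    by (rule bounded_subset[rotated]) (simp flip: interval_cbox_cart)
  moreover have "zstar \<in> Low b F"
    using fixpoint by (simp add: Low_def)
  ultimately show ?thesis
    using below by blast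
qed

end
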